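(* For each integer $N\ge 1$ let $(J_{ij})_{1\le i,j\le N}$ be i.i.d. Gaussian random variables with mean $0$ and variance $1$, let $$H(\eta)=\frac{1}{\sqrt N}\sum_{i,j=1}^N J_{ij}\eta_i\eta_j,\qquad \eta\in\{0,1\}^N,$$ and for $m>0$ let $\nu(m)$ be the (random) number of configurations $\eta\in\{0,1\}^N$ such that $H(\eta)<-mN$. Then for $.562<m<.801$ the probability $P(\exists\,\eta\in\{0,1\}^N:\ H(\eta)<-mN)$ that there is some configuration $\eta$ with $H(\eta)<-mN$ is exponentially small in $N$, while the average number $E(\nu(m))$ of configurations $\eta$ with $H(\eta)<-mN$ is exponentially large in $N$.
   Context: The sum defining $H$ runs over all pairs $(i,j)\in\{1,\dots,N\}^2$, including the terms $i=j$. $P$ and $E$ denote probability and expectation with respect to the variables $J_{ij}$. The endpoints are decimal values obtained by numerical evaluation: with $I(\alpha)=-\alpha\ln\alpha-(1-\alpha)\ln(1-\alpha)$, the value $.801$ is the numerically computed value of $m$ above which $I(\alpha)-\frac{m^2}{2\alpha^2}<0$ for all $\alpha$, and $.562$ is the numerically computed value of $m$ above which $I(\alpha)-\frac{m^2}{2\alpha^2(1-\alpha^2)}<0$ for all $\alpha$.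
   Formalization: The endpoints .562 and .801 are replaced by the exact thresholds they approximate (about .562205 and .80097), shown to lie within .0005 of them; with the literal decimals the claim fails, since for .80097<m<.801 the average E(ν(m)) is exponentially small. *)

theory Defs
  imports "HOL-Probability.Probability"
begin

definition configs :: "nat \<Rightarrow> (nat \<Rightarrow> real) set" where
  "configs N = {1..N} \<rightarrow>\<^sub>E {0, 1}"

definition hamiltonian :: "nat \<Rightarrow> (nat \<Rightarrow> nat \<Rightarrow> real) \<Rightarrow> (nat \<Rightarrow> real) \<Rightarrow> real" where
  "hamiltonian N J \<eta> = 1 / sqrt (real N) * (\<Sum>i=1..N. \<Sum>j=1..N. J i j * \<eta> i * \<eta> j)"

definition low_energy_count :: "nat \<Rightarrow> (nat \<Rightarrow> nat \<Rightarrow> real) \<Rightarrow> real \<Rightarrow> nat" where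
  "low_energy_count N J m = card {\<eta> \<in> configs N. hamiltonian N J \<eta> < - m * real N}"

definition entropy_fn :: "real \<Rightarrow> real" where
  "entropy_fn \<alpha> = - \<alpha> * ln \<alpha> - (1 - \<alpha>) * ln (1 - \<alpha>)"

(* The exact values whose three-digit decimal evaluations are .801 and .562.
   The density \<alpha> of ones ranges over the open interval (0,1) only: at \<alpha> = 0 and \<alpha> = 1 a
   denominator vanishes, and the convention x / 0 = 0 would replace the intended value
   minus infinity of the exponent by 0. *)

definition first_moment_threshold :: real where
  "first_moment_threshold =
     Inf {m\<^sub>0. m\<^sub>0 > 0 \<and>
            (\<forall>m>m\<^sub>0. \<forall>\<alpha>\<in>{0<..<1}. entropy_fn \<alpha> - m\<^sup>2 / (2 * \<alpha>\<^sup>2) < 0)}"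

definition existence_threshold :: real where
  "existence_threshold =
     Inf {m\<^sub>0. m\<^sub>0 > 0 \<and>
            (\<forall>m>m\<^sub>0. \<forall>\<alpha>\<in>{0<..<1}. entropy_fn \<alpha> - m\<^sup>2 / (2 * \<alpha>\<^sup>2 * (1 - \<alpha>\<^sup>2)) < 0)}"

definition exponentially_small :: "(nat \<Rightarrow> real) \<Rightarrow> bool" where
  "exponentially_small p \<longleftrightarrow> (\<exists>c>0. \<forall>\<^sub>F N in sequentially. p N \<le> exp (- c * real N))"

definition exponentially_large :: "(nat \<Rightarrow> real) \<Rightarrow> bool" where
  "exponentially_large x \<longleftrightarrow> (\<exists>c>0. \<forall>\<^sub>F N in sequentially. x N \<ge> exp (c * real N))"

end

(* Let S be the sum of all couplings divided by N, a standard normal variable. For a configuration of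
   density \<alpha>, H(\<eta>) is \<alpha>^2 sqrt N S plus an independent Gaussian remainder of variance
   \<alpha>^2 (1 - \<alpha>^2) N instead of \<alpha>^2 N. Outside the exponentially unlikely event S < -\<epsilon> sqrt N, a low
   energy forces a low remainder, and the union bound with the smaller variance gives the threshold
   .562. The first moment also counts the rare event of an atypical S, hence its threshold .801.

   Both thresholds are square roots of maxima over \<alpha> of a weight times the entropy. Gibbs' inequality
   with a rational reference density near the maximizer replaces the entropy by a linear function, so
   that the numerical upper bounds become polynomial inequalities on the unit interval. *)
theory Submission
  imports Defs "HOL-Real_Asymp.Real_Asymp"
begin

section \<open>Numerical bounds for the entropy exponents and the two thresholds\<close>

text \<open>Applying \<open>ln x \<le> x - 1\<close> to both ratios of reference weight to actual
  weight gives linear terms that cancel. The bound is affine in \<open>\<alpha>\<close> and tangent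
  to the entropy at \<open>\<beta>\<close>, so little is lost near \<open>\<beta>\<close>.\<close>

lemma entropy_fn_le_cross_entropy:
  fixes \<alpha> \<beta> :: real
  assumes "0 < \<alpha>" "\<alpha> < 1" "0 < \<beta>" "\<beta> < 1"
  shows "entropy_fn \<alpha> \<le> - \<alpha> * ln \<beta> - (1 - \<alpha>) * ln (1 - \<beta>)"
proof -
  have "\<alpha> * ln (\<beta> / \<alpha>) \<le> \<alpha> * (\<beta> / \<alpha> - 1)"
    using assms by (intro mult_left_mono ln_le_minus_one) auto
  also have "\<dots> = \<beta> - \<alpha>"
    using assms by (simp add: field_simps)
  finally have *: "\<alpha> * ln (\<beta> / \<alpha>) \<le> \<beta> - \<alpha>" .
  have "(1 - \<alpha>) * ln ((1 - \<beta>) / (1 - \<alpha>)) \<le> (1 - \<alpha>) * ((1 - \<beta>) / (1 - \<alpha>) - 1)"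
    using assms by (intro mult_left_mono ln_le_minus_one) auto
  also have "\<dots> = (1 - \<beta>) - (1 - \<alpha>)"
    using assms by (subst right_diff_distrib) simp
  finally have "\<alpha> * ln (\<beta> / \<alpha>) + (1 - \<alpha>) * ln ((1 - \<beta>) / (1 - \<alpha>)) \<le> 0"
    using * by linarith
  then show ?thesis
    using assms by (simp add: entropy_fn_def ln_div algebra_simps)
qed

text \<open>The four logarithms bounded from here on belong to the reference densities 11/14 and
  9/14 and their complements 3/14 and 5/14. The further the argument lies from 1, the more series
  terms are taken.\<close>

lemma ln_14_over_11_bounds: "ln (14/11::real) \<in> {2411/10000 .. 2412/10000}"
  using ln_approx_bounds[of "14/11" 3] by (simp add: eval_nat_numeral)

lemma ln_14_over_3_bounds: "ln (14/3::real) \<in> {15404/10000 .. 15406/10000}"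
  using ln_approx_bounds[of "14/3" 9] by (simp add: eval_nat_numeral)

lemma ln_14_over_9_bounds: "ln (14/9::real) \<in> {4418/10000 .. 4419/10000}"
  using ln_approx_bounds[of "14/9" 4] by (simp add: eval_nat_numeral)

lemma ln_14_over_5_bounds: "ln (14/5::real) \<in> {10296/10000 .. 10297/10000}"
  using ln_approx_bounds[of "14/5" 6] by (simp add: eval_nat_numeral)

text \<open>The affine entropy bound with reference 11/14, close to the maximizer, turns the claim
  into a cubic inequality. The constant lies just below the square of .8014.\<close>

lemma first_moment_exponent_le:
  assumes "0 < \<alpha>" "\<alpha> < 1"
  shows "2 * \<alpha>\<^sup>2 * entropy_fn \<alpha> \<le> 2007/3125"
proof -
  have ln: "- ln (11/14 :: real) = ln (14/11)" "- ln (3/14 :: real) = ln (14/3)"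
    by (simp_all add: ln_div)
  have "entropy_fn \<alpha> \<le> \<alpha> * ln (14/11) + (1 - \<alpha>) * ln (14/3)"
    using entropy_fn_le_cross_entropy[of \<alpha> "11/14"] assms by (simp flip: ln)
  also have "\<dots> \<le> \<alpha> * (603/2500) + (1 - \<alpha>) * (7703/5000)"
    using assms ln_14_over_11_bounds ln_14_over_3_bounds by (intro add_mono mult_left_mono) auto
  finally have "2 * \<alpha>\<^sup>2 * entropy_fn \<alpha> \<le> 2 * \<alpha>\<^sup>2 * (\<alpha> * (603/2500) + (1 - \<alpha>) * (7703/5000))"
    by (intro mult_left_mono) auto
  \<comment> \<open>Dividing the difference by the square of the distance to its approximate minimizer leaves a
    positive linear remainder.\<close>
  also have "\<dots> = 2007/3125 - (\<alpha> - (494/625))\<^sup>2 * ((6497/2500) * \<alpha> + (1604661/1562500))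
      - ((99283926/152587890625) - (24206/244140625) * \<alpha>)"
    by algebra
  also have "\<dots> \<le> 2007/3125"
  proof -
    have "0 \<le> (\<alpha> - (494/625))\<^sup>2 * ((6497/2500) * \<alpha> + (1604661/1562500))"
      using assms by (intro mult_nonneg_nonneg) auto
    then show ?thesis using assms by linarith
  qed
  finally show ?thesis .
qed

text \<open>The same method with reference 9/14 leads to a quintic inequality; the constant lies
  just below the square of .5624.\<close>

lemma existence_exponent_le:
  assumes "0 < \<alpha>" "\<alpha> < 1"
  shows "2 * \<alpha>\<^sup>2 * (1 - \<alpha>\<^sup>2) * entropy_fn \<alpha> \<le> 31629/100000"
proof -
  have ln: "- ln (9/14 :: real) = ln (14/9)" "- ln (5/14 :: real) = ln (14/5)"
    by (simp_all add: ln_div)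
  have sq: "\<alpha>\<^sup>2 \<le> 1" using assms by (simp add: power_le_one)
  have "entropy_fn \<alpha> \<le> \<alpha> * ln (14/9) + (1 - \<alpha>) * ln (14/5)"
    using entropy_fn_le_cross_entropy[of \<alpha> "9/14"] assms by (simp flip: ln)
  also have "\<dots> \<le> \<alpha> * (4419/10000) + (1 - \<alpha>) * (10297/10000)"
    using assms ln_14_over_9_bounds ln_14_over_5_bounds by (intro add_mono mult_left_mono) auto
  finally have "2 * \<alpha>\<^sup>2 * (1 - \<alpha>\<^sup>2) * entropy_fn \<alpha>
      \<le> 2 * \<alpha>\<^sup>2 * (1 - \<alpha>\<^sup>2) * (\<alpha> * (4419/10000) + (1 - \<alpha>) * (10297/10000))"
    using sq by (intro mult_left_mono) auto
  \<comment> \<open>Dividing the gap by the square of the distance to its approximate minimizer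
    12883/20000 leaves a cubic cofactor and an affine remainder that is positive on the unit
    interval.\<close>
  also have "\<dots> = 31629/100000
      - (\<alpha> - (12883/20000))\<^sup>2 * ((3808997213519107/5000000000000000) + (2365352638087/1000000000000) * \<alpha> + (13621863/25000000) * \<alpha>\<^sup>2 - (2939/2500) * \<alpha>^3)
      - ((394299075940177438277/2000000000000000000000000) - (2216721954375019/80000000000000000000) * \<alpha>)"
    by algebra
  also have "\<dots> \<le> 31629/100000"
  proof -
    \<comment> \<open>The only negative coefficient of the cofactor is the cubic one; the linear
      term absorbs it.\<close>
    have "\<alpha>^3 \<le> \<alpha>" using power_decreasing[of 1 3 \<alpha>] assms by simp
    then have "0 \<le> (3808997213519107/5000000000000000) + (2365352638087/1000000000000) * \<alpha> + (13621863/25000000) * \<alpha>\<^sup>2 - (2939/2500) * \<alpha>^3"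
      using assms zero_le_power2[of \<alpha>] by linarith
    then have "0 \<le> (\<alpha> - (12883/20000))\<^sup>2 *
        ((3808997213519107/5000000000000000) + (2365352638087/1000000000000) * \<alpha> + (13621863/25000000) * \<alpha>\<^sup>2 - (2939/2500) * \<alpha>^3)"
      by (intro mult_nonneg_nonneg) auto
    then show ?thesis using assms by linarith
  qed
  finally show ?thesis .
qed

text \<open>A lower bound for a maximum needs one density only. At the reference density Gibbs'
  bound is an equality, so the same two logarithms decide. The constant exceeds the square of
  .8006.\<close>

lemma first_moment_exponent_ge: "6413/10000 \<le> 2 * (11/14)\<^sup>2 * entropy_fn (11/14)"
proof -
  have ln: "- ln (11/14 :: real) = ln (14/11)" "- ln (3/14 :: real) = ln (14/3)"
    by (simp_all add: ln_div)
  have "entropy_fn (11/14) = 11/14 * ln (14/11) + 3/14 * ln (14/3)"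
    by (simp add: entropy_fn_def flip: ln)
  then show ?thesis
    using ln_14_over_11_bounds ln_14_over_3_bounds by (simp add: power2_eq_square field_simps)
qed

lemma existence_exponent_ge: "79/250 \<le> 2 * (9/14)\<^sup>2 * (1 - (9/14)\<^sup>2) * entropy_fn (9/14)"
proof -
  have ln: "- ln (9/14 :: real) = ln (14/9)" "- ln (5/14 :: real) = ln (14/5)"
    by (simp_all add: ln_div)
  have "entropy_fn (9/14) = 9/14 * ln (14/9) + 5/14 * ln (14/5)"
    by (simp add: entropy_fn_def flip: ln)
  then show ?thesis
    using ln_14_over_9_bounds ln_14_over_5_bounds by (simp add: power2_eq_square field_simps)
qed

text \<open>Both thresholds are infima of this form, with \<open>w\<close> twice the variance of the energy (respectively
  of its remainder) divided by \<open>N\<close>.\<close>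

definition decay_bounds :: "(real \<Rightarrow> real) \<Rightarrow> real set" where
  "decay_bounds w =
     {m\<^sub>0. m\<^sub>0 > 0 \<and> (\<forall>m>m\<^sub>0. \<forall>\<alpha>\<in>{0<..<1}. entropy_fn \<alpha> - m\<^sup>2 / w \<alpha> < 0)}"

lemma first_moment_threshold_eq: "first_moment_threshold = Inf (decay_bounds (\<lambda>\<alpha>. 2 * \<alpha>\<^sup>2))"
  by (simp add: first_moment_threshold_def decay_bounds_def)

lemma existence_threshold_eq:
  "existence_threshold = Inf (decay_bounds (\<lambda>\<alpha>. 2 * \<alpha>\<^sup>2 * (1 - \<alpha>\<^sup>2)))"
  by (simp add: existence_threshold_def decay_bounds_def)

lemma bdd_below_decay_bounds: "bdd_below (decay_bounds w)"
  by (rule bdd_belowI[of _ 0]) (auto simp: decay_bounds_def)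

context
  fixes w :: "real \<Rightarrow> real"
  assumes w_pos: "\<And>\<alpha>. 0 < \<alpha> \<Longrightarrow> \<alpha> < 1 \<Longrightarrow> 0 < w \<alpha>"
begin

lemma mem_decay_boundsI:
  assumes "0 < u" "\<And>\<alpha>. 0 < \<alpha> \<Longrightarrow> \<alpha> < 1 \<Longrightarrow> w \<alpha> * entropy_fn \<alpha> \<le> u\<^sup>2"
  shows "u \<in> decay_bounds w"
proof -
  have "entropy_fn \<alpha> < m\<^sup>2 / w \<alpha>" if "u < m" "0 < \<alpha>" "\<alpha> < 1" for m \<alpha>
  proof -
    have "w \<alpha> * entropy_fn \<alpha> \<le> u\<^sup>2" using assms(2) that by blast
    also have "\<dots> < m\<^sup>2" using that assms(1) by (intro power_strict_mono) auto
    finally show ?thesis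
      using w_pos[OF that(2,3)] by (simp add: pos_less_divide_eq mult.commute)
  qed
  then show ?thesis using assms(1) by (auto simp: decay_bounds_def)
qed

text \<open>If \<open>m < l\<close>, the condition on \<open>m\<close> is tested at \<open>l\<close>
  itself, where the exponent at \<open>\<alpha>\<close> is not negative.\<close>

lemma decay_bounds_ge:
  assumes "0 < \<alpha>" "\<alpha> < 1" "l\<^sup>2 \<le> w \<alpha> * entropy_fn \<alpha>" "m \<in> decay_bounds w"
  shows "l \<le> m"
proof (rule ccontr)
  assume "\<not> l \<le> m"
  then have "entropy_fn \<alpha> < l\<^sup>2 / w \<alpha>"
    using assms by (auto simp: decay_bounds_def)
  then show False
    using w_pos[OF assms(1,2)] assms(3) by (simp add: pos_less_divide_eq mult.commute)
qed

text \<open>The strict gap between \<open>m\<^sub>0\<close> and \<open>m\<close> is the source of an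
  exponential rate that is uniform in the density.\<close>

lemma exponent_bound_above_Inf:
  assumes "decay_bounds w \<noteq> {}" "Inf (decay_bounds w) < m"
  obtains m\<^sub>0 where "0 < m\<^sub>0" "m\<^sub>0 < m"
    "\<And>\<alpha>. 0 < \<alpha> \<Longrightarrow> \<alpha> < 1 \<Longrightarrow> w \<alpha> * entropy_fn \<alpha> \<le> m\<^sub>0\<^sup>2"
proof -
  obtain m\<^sub>1 where m1: "m\<^sub>1 \<in> decay_bounds w" "m\<^sub>1 < m"
    using cInf_lessD[OF assms] by blast
  show thesis
  \<comment> \<open>A member of the set controls only values strictly above it, hence the midpoint
    instead of \<open>m\<^sub>1\<close>.\<close>
  proof (rule that[of "(m\<^sub>1 + m) / 2"])
    show "w \<alpha> * entropy_fn \<alpha> \<le> ((m\<^sub>1 + m) / 2)\<^sup>2" if "0 < \<alpha>" "\<alpha> < 1" for \<alpha>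
    proof -
      have "entropy_fn \<alpha> < ((m\<^sub>1 + m) / 2)\<^sup>2 / w \<alpha>"
        using m1 that by (force simp: decay_bounds_def)
      then show ?thesis
        using w_pos[OF that] by (simp add: pos_less_divide_eq mult.commute)
    qed
  qed (use m1 in \<open>auto simp: decay_bounds_def\<close>)
qed

lemma exponent_gt_below_Inf:
  assumes "0 < m" "m < Inf (decay_bounds w)"
  obtains \<alpha> where "0 < \<alpha>" "\<alpha> < 1" "m\<^sup>2 < w \<alpha> * entropy_fn \<alpha>"
proof -
  have "m \<notin> decay_bounds w"
    using assms(2) cInf_lower[OF _ bdd_below_decay_bounds] by force
  then obtain m' \<alpha> where *: "m < m'" "0 < \<alpha>" "\<alpha> < 1" "m'\<^sup>2 / w \<alpha> \<le> entropy_fn \<alpha>"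
    using assms(1) by (auto simp: decay_bounds_def not_less)
  have "m\<^sup>2 < m'\<^sup>2" using * assms(1) by (intro power_strict_mono) auto
  also have "\<dots> \<le> w \<alpha> * entropy_fn \<alpha>"
    using *(4) w_pos[OF *(2,3)] by (simp add: pos_divide_le_eq mult.commute)
  finally show thesis using that * by blast
qed

end

lemma first_moment_weight_pos: "0 < 2 * \<alpha>\<^sup>2" if "0 < \<alpha>" for \<alpha> :: real
  using that by simp

lemma existence_weight_pos: "0 < 2 * \<alpha>\<^sup>2 * (1 - \<alpha>\<^sup>2)" if "0 < \<alpha>" "\<alpha> < 1" for \<alpha> :: real
  using that power_strict_mono[of \<alpha> 1 2] by simp

lemma mem_first_moment_decay_bounds: "4007/5000 \<in> decay_bounds (\<lambda>\<alpha>. 2 * \<alpha>\<^sup>2)"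
proof (rule mem_decay_boundsI)
  show "2 * \<alpha>\<^sup>2 * entropy_fn \<alpha> \<le> (4007/5000)\<^sup>2" if "0 < \<alpha>" "\<alpha> < 1" for \<alpha> :: real
    by (rule order_trans[OF first_moment_exponent_le[OF that]]) (simp add: power2_eq_square)
qed auto

lemma mem_existence_decay_bounds: "703/1250 \<in> decay_bounds (\<lambda>\<alpha>. 2 * \<alpha>\<^sup>2 * (1 - \<alpha>\<^sup>2))"
proof (rule mem_decay_boundsI)
  show "2 * \<alpha>\<^sup>2 * (1 - \<alpha>\<^sup>2) * entropy_fn \<alpha> \<le> (703/1250)\<^sup>2" if "0 < \<alpha>" "\<alpha> < 1" for \<alpha> :: real
    by (rule order_trans[OF existence_exponent_le[OF that]]) (simp add: power2_eq_square)
qed (use existence_weight_pos in auto)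

text \<open>A member of the set bounds the infimum above, a single density bounds it below. The
  interval [.8006, .8014] lies within .0005 of .801.\<close>

lemma first_moment_threshold_bounds: "first_moment_threshold \<in> {4003/5000..4007/5000}"
proof -
  have "first_moment_threshold \<le> 4007/5000"
    unfolding first_moment_threshold_eq
    by (intro cInf_lower mem_first_moment_decay_bounds bdd_below_decay_bounds)
  moreover have "4003/5000 \<le> first_moment_threshold"
    unfolding first_moment_threshold_eq
  proof (rule cInf_greatest)
    show "4003/5000 \<le> m" if "m \<in> decay_bounds (\<lambda>\<alpha>. 2 * \<alpha>\<^sup>2)" for m
    proof (rule decay_bounds_ge[OF _ _ _ _ that])
      show "(4003/5000)\<^sup>2 \<le> 2 * (11/14)\<^sup>2 * entropy_fn (11/14)"
        by (rule order_trans[OF _ first_moment_exponent_ge]) (simp add: power2_eq_square)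
    qed (use first_moment_weight_pos in auto)
  qed (use mem_first_moment_decay_bounds in blast)
  ultimately show ?thesis by simp
qed

lemma existence_threshold_bounds: "existence_threshold \<in> {281/500..703/1250}"
proof -
  have "existence_threshold \<le> 703/1250"
    unfolding existence_threshold_eq
    by (intro cInf_lower mem_existence_decay_bounds bdd_below_decay_bounds)
  moreover have "281/500 \<le> existence_threshold"
    unfolding existence_threshold_eq
  proof (rule cInf_greatest)
    show "281/500 \<le> m" if "m \<in> decay_bounds (\<lambda>\<alpha>. 2 * \<alpha>\<^sup>2 * (1 - \<alpha>\<^sup>2))" for m
    proof (rule decay_bounds_ge[OF _ _ _ _ that])
      show "(281/500)\<^sup>2 \<le> 2 * (9/14)\<^sup>2 * (1 - (9/14)\<^sup>2) * entropy_fn (9/14)"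
        by (rule order_trans[OF _ existence_exponent_ge]) (simp add: power2_eq_square)
    qed (use existence_weight_pos in auto)
  qed (use mem_existence_decay_bounds in blast)
  ultimately show ?thesis by simp
qed

section \<open>Binomial coefficients and the entropy\<close>

text \<open>The weights \<open>k ^ j / fact j\<close> are largest at \<open>j = k\<close>, since
  consecutive ones have ratio \<open>k / (j + 1)\<close>; denominators are cleared. The two
  inductions move away from \<open>k\<close> upwards and downwards.\<close>

lemma fact_mult_power_le: "fact k * k ^ j \<le> fact j * (k ^ k :: nat)"
proof (cases "k \<le> j")
  case True
  then show ?thesis
  proof (induction rule: dec_induct)
    case (step n)
    have "k * (fact k * k ^ n) \<le> Suc n * (fact n * k ^ k)"
      using step.hyps by (intro mult_le_mono step.IH) auto
    then show ?case by (simp only: power_Suc fact_Suc of_nat_id mult_ac)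
  qed simp
next
  case False
  then have "j \<le> k" by simp
  then show ?thesis
  proof (induction rule: inc_induct)
    case (step n)
    have "k * (fact k * k ^ n) \<le> Suc n * (fact n * k ^ k)"
      using step.IH by (simp only: power_Suc fact_Suc of_nat_id mult_ac)
    also have "\<dots> \<le> k * (fact n * k ^ k)"
      using step.hyps by (intro mult_le_mono) auto
    finally show ?case using step.hyps by simp
  qed simp
qed

text \<open>Up to the factor \<open>fact N\<close>, a binomial term is a product of two weights
  \<open>k ^ j / fact j\<close>, one for \<open>k\<close> and one for \<open>N - k\<close>, and both
  are largest at \<open>j = k\<close>.\<close>

lemma binomial_term_le_mode:
  assumes "k \<le> N" "j \<le> N"
  shows "real (N choose j) * real k ^ j * real (N - k) ^ (N - j)
      \<le> real (N choose k) * real k ^ k * real (N - k) ^ (N - k)"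
proof -
  have *: "real k ^ j / fact j \<le> real k ^ k / fact k" for k j :: nat
  proof -
    have "real (fact k * k ^ j) \<le> real (fact j * k ^ k)"
      using fact_mult_power_le of_nat_mono by blast
    then show ?thesis by (simp add: field_simps)
  qed
  have eq: "real (N choose j) * real k ^ j * real (N - k) ^ (N - j)
      = fact N * ((real k ^ j / fact j) * (real (N - k) ^ (N - j) / fact (N - j)))"
    if "j \<le> N" for j
    using that by (simp add: binomial_fact)
  show ?thesis
    unfolding eq[OF assms(1)] eq[OF assms(2)]
    by (intro mult_left_mono mult_mono *) auto
qed

text \<open>With \<open>p = k / N\<close>, the weight \<open>p ^ k * (1 - p) ^ (N - k)\<close> of a
  single sequence is the exponential of minus \<open>N\<close> times the entropy of
  \<open>p\<close>; denominators are cleared.\<close>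

lemma exp_entropy_fn:
  assumes "0 < k" "k < N"
  shows "exp (real N * entropy_fn (real k / real N)) * (real k ^ k * real (N - k) ^ (N - k))
    = real N ^ N"
proof -
  have "1 - real k / real N = real (N - k) / real N"
    using assms by (simp add: field_simps of_nat_diff)
  then have "real N * entropy_fn (real k / real N)
      = - real k * ln (real k / real N) - real (N - k) * ln (real (N - k) / real N)"
    using assms by (simp add: entropy_fn_def right_diff_distrib)
  also have "\<dots> = real N * ln (real N) - real k * ln (real k) - real (N - k) * ln (real (N - k))"
    using assms by (simp add: ln_div of_nat_diff algebra_simps)
  also have "exp \<dots> = exp (real N * ln (real N)) / exp (real k * ln (real k))
      / exp (real (N - k) * ln (real (N - k)))"
    by (simp add: exp_diff)
  also have "\<dots> = real N ^ N / real k ^ k / real (N - k) ^ (N - k)"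
    using assms by (simp only: exp_of_nat_mult exp_ln of_nat_0_less_iff zero_less_diff)
  finally show ?thesis
    using assms by simp
qed

text \<open>One term of the binomial expansion of \<open>(k + (N - k)) ^ N\<close> is at most the
  whole sum.\<close>

lemma binomial_le_exp_entropy:
  assumes "0 < k" "k < N"
  shows "real (N choose k) \<le> exp (real N * entropy_fn (real k / real N))"
proof -
  have pos: "0 < real k ^ k * real (N - k) ^ (N - k)" using assms by simp
  have "real (N choose k) * (real k ^ k * real (N - k) ^ (N - k))
      \<le> (\<Sum>j\<le>N. real (N choose j) * real k ^ j * real (N - k) ^ (N - j))"
    using assms member_le_sum[of k "{..N}" "\<lambda>j. real (N choose j) * real k ^ j * real (N - k) ^ (N - j)"]
    by (simp add: mult.assoc)
  also have "\<dots> = (real k + real (N - k)) ^ N"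
    by (simp add: binomial_ring)
  also have "\<dots> = exp (real N * entropy_fn (real k / real N)) * (real k ^ k * real (N - k) ^ (N - k))"
    using exp_entropy_fn[OF assms] assms by (simp add: of_nat_diff)
  finally show ?thesis using pos by (simp only: mult_le_cancel_right_pos)
qed

text \<open>The same term is the largest of the \<open>N + 1\<close> terms, so the sum exceeds it by
  at most that factor.\<close>

lemma exp_entropy_le_binomial:
  assumes "0 < k" "k < N"
  shows "exp (real N * entropy_fn (real k / real N)) \<le> (real N + 1) * real (N choose k)"
proof -
  have pos: "0 < real k ^ k * real (N - k) ^ (N - k)" using assms by simp
  have "exp (real N * entropy_fn (real k / real N)) * (real k ^ k * real (N - k) ^ (N - k))
      = (real k + real (N - k)) ^ N"
    using exp_entropy_fn[OF assms] assms by (simp add: of_nat_diff)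
  also have "\<dots> = (\<Sum>j\<le>N. real (N choose j) * real k ^ j * real (N - k) ^ (N - j))"
    by (simp add: binomial_ring)
  also have "\<dots> \<le> (\<Sum>j\<le>N. real (N choose k) * real k ^ k * real (N - k) ^ (N - k))"
    using assms by (intro sum_mono binomial_term_le_mode) auto
  also have "\<dots> = (real N + 1) * real (N choose k) * (real k ^ k * real (N - k) ^ (N - k))"
    by (simp add: mult.assoc add.commute)
  finally show ?thesis using pos by (simp only: mult_le_cancel_right_pos)
qed

section \<open>Configurations as sets of occupied sites\<close>

text \<open>The restriction makes values outside \<open>{1..N}\<close> equal to
  \<open>undefined\<close>, as membership in the extensional space \<open>configs N\<close>
  demands.\<close>

definition config_of :: "nat \<Rightarrow> nat set \<Rightarrow> nat \<Rightarrow> real" where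
  "config_of N A = restrict (indicator A) {1..N}"

lemma bij_betw_config_of: "bij_betw (config_of N) (Pow {1..N}) (configs N)"
proof (rule bij_betw_byWitness[where f' = "\<lambda>\<eta>. {i\<in>{1..N}. \<eta> i = 1}"])
  show "\<forall>\<eta>\<in>configs N. config_of N {i\<in>{1..N}. \<eta> i = 1} = \<eta>"
  proof
    fix \<eta> assume \<eta>: "\<eta> \<in> configs N"
    show "config_of N {i\<in>{1..N}. \<eta> i = 1} = \<eta>"
    proof
      fix i
      show "config_of N {i\<in>{1..N}. \<eta> i = 1} i = \<eta> i"
        using PiE_mem[OF \<eta>[unfolded configs_def], of i] PiE_arb[OF \<eta>[unfolded configs_def], of i]
        by (cases "i \<in> {1..N}") (auto simp: config_of_def)
    qed
  qed
qed (auto simp: config_of_def configs_def indicator_def)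

lemma hamiltonian_config_of:
  assumes "A \<subseteq> {1..N}"
  shows "hamiltonian N J (config_of N A) = (\<Sum>p\<in>A \<times> A. J (fst p) (snd p)) / sqrt (real N)"
proof -
  have restrict: "(\<Sum>i=1..N. indicator A i * f i) = sum f A" for f :: "nat \<Rightarrow> real"
    using assms by (intro sum.mono_neutral_cong_right) auto
  have "(\<Sum>i=1..N. \<Sum>j=1..N. J i j * config_of N A i * config_of N A j)
      = (\<Sum>i=1..N. indicator A i * (\<Sum>j=1..N. indicator A j * J i j))"
    unfolding sum_distrib_left by (intro sum.cong refl) (simp add: config_of_def)
  also have "\<dots> = (\<Sum>i\<in>A. \<Sum>j\<in>A. J i j)"
    by (simp only: restrict)
  also have "\<dots> = (\<Sum>p\<in>A \<times> A. J (fst p) (snd p))"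
    by (simp add: sum.cartesian_product split_beta)
  finally show ?thesis by (simp add: hamiltonian_def)
qed

text \<open>The tail bounds concern block sums, so the level is rescaled by \<open>sqrt N\<close>,
  which is positive as \<open>1 \<le> N\<close>.\<close>

lemma low_energy_iff:
  assumes "A \<subseteq> {1..N}" "1 \<le> N"
  shows "hamiltonian N J (config_of N A) < - m * real N
    \<longleftrightarrow> (\<Sum>p\<in>A \<times> A. J (fst p) (snd p)) < - (m * real N * sqrt (real N))"
  using assms by (simp add: hamiltonian_config_of pos_divide_less_eq)

lemma low_energy_count_eq:
  assumes "1 \<le> N"
  shows "low_energy_count N J m
    = card {A\<in>Pow {1..N}. (\<Sum>p\<in>A \<times> A. J (fst p) (snd p)) < - (m * real N * sqrt (real N))}"
    (is "_ = card ?L")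
proof -
  have "{\<eta> \<in> configs N. hamiltonian N J \<eta> < - m * real N} = config_of N ` ?L"
    using low_energy_iff[OF _ assms, of _ J m]
    by (auto simp flip: bij_betw_imp_surj_on[OF bij_betw_config_of])
  moreover have "inj_on (config_of N) ?L"
    using bij_betw_imp_inj_on[OF bij_betw_config_of] by (rule inj_on_subset) auto
  ultimately show ?thesis
    by (simp add: low_energy_count_def card_image)
qed

lemma ex_low_energy_iff:
  assumes "1 \<le> N"
  shows "(\<exists>\<eta>\<in>configs N. hamiltonian N J \<eta> < - m * real N)
    \<longleftrightarrow> (\<exists>A\<subseteq>{1..N}. (\<Sum>p\<in>A \<times> A. J (fst p) (snd p)) < - (m * real N * sqrt (real N)))"
  using low_energy_iff[OF _ assms, of _ J m]
  by (auto simp flip: bij_betw_imp_surj_on[OF bij_betw_config_of])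

section \<open>Gaussian exponential moments and tail bounds\<close>

text \<open>Completing the square turns \<open>exp (s * x)\<close> times the standard density into
  \<open>exp (s\<^sup>2 / 2)\<close> times the normal density of mean \<open>s\<close>, which has
  mass 1.\<close>

lemma (in prob_space) nn_integral_exp_std_normal:
  assumes "distributed M lborel X (\<lambda>x. ennreal (normal_density 0 1 x))"
  shows "(\<integral>\<^sup>+\<omega>. ennreal (exp (s * X \<omega>)) \<partial>M) = ennreal (exp (s\<^sup>2 / 2))"
proof -
  interpret N: prob_space "density lborel (normal_density s 1)"
    by (rule prob_space_normal_density) simp
  have "(\<integral>\<^sup>+\<omega>. ennreal (exp (s * X \<omega>)) \<partial>M)
      = (\<integral>\<^sup>+x. ennreal (normal_density 0 1 x) * ennreal (exp (s * x)) \<partial>lborel)"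
    by (rule distributed_nn_integral[OF assms, symmetric]) simp
  also have "\<dots> = (\<integral>\<^sup>+x. ennreal (exp (s\<^sup>2 / 2)) * ennreal (normal_density s 1 x) \<partial>lborel)"
  proof (rule nn_integral_cong)
    fix x :: real
    have "normal_density 0 1 x * exp (s * x) = exp (s\<^sup>2 / 2) * normal_density s 1 x"
      by (simp add: normal_density_def mult_exp_exp power2_eq_square field_simps)
    then show "ennreal (normal_density 0 1 x) * ennreal (exp (s * x))
        = ennreal (exp (s\<^sup>2 / 2)) * ennreal (normal_density s 1 x)"
      by (simp flip: ennreal_mult)
  qed
  also have "\<dots> = ennreal (exp (s\<^sup>2 / 2)) * (\<integral>\<^sup>+x. ennreal (normal_density s 1 x) \<partial>lborel)"
    by (rule nn_integral_cmult) simp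
  also have "(\<integral>\<^sup>+x. ennreal (normal_density s 1 x) \<partial>lborel) = 1"
    using N.emeasure_space_1 by (simp add: emeasure_density)
  finally show ?thesis by simp
qed

text \<open>Chernoff's method: independence factorizes the exponential moment. \<open>V\<close>
  enters through an equation, so that the variance can be supplied in evaluated form.\<close>

lemma (in prob_space) gaussian_lower_tail_le:
  fixes X :: "'i \<Rightarrow> 'a \<Rightarrow> real" and c :: "'i \<Rightarrow> real"
  assumes I: "finite I" and indep: "indep_vars (\<lambda>_. borel) X I"
    and distr: "\<And>i. i \<in> I \<Longrightarrow> distributed M lborel (X i) (\<lambda>x. ennreal (normal_density 0 1 x))"
    and V: "(\<Sum>i\<in>I. (c i)\<^sup>2) = V" "0 < V" and t: "0 < t"
  shows "prob {\<omega>\<in>space M. (\<Sum>i\<in>I. c i * X i \<omega>) \<le> - t} \<le> exp (- (t\<^sup>2 / (2 * V)))"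
proof -
  \<comment> \<open>This choice minimizes the Chernoff exponent
    \<open>s\<^sup>2 * V / 2 - s * t\<close>.\<close>
  define s where "s = t / V"
  have s: "0 < s" using V t by (simp add: s_def)
  have rv [measurable]: "X i \<in> borel_measurable M" if "i \<in> I" for i
    using distributed_measurable[OF distr[OF that]] by simp
  have rv': "(\<lambda>\<omega>. \<Sum>i\<in>I. c i * X i \<omega>) \<in> borel_measurable M" by measurable
  have "emeasure M {\<omega>\<in>space M. (\<Sum>i\<in>I. c i * X i \<omega>) \<le> - t} \<le>
      ennreal (exp (s * - t)) *
        (\<integral>\<^sup>+\<omega>. ennreal (exp (- s * (\<Sum>i\<in>I. c i * X i \<omega>))) * indicator (space M) \<omega> \<partial>M)"
    by (rule Chernoff_ineq_nn_integral_le[OF s _ rv']) simp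
  also have "(\<integral>\<^sup>+\<omega>. ennreal (exp (- s * (\<Sum>i\<in>I. c i * X i \<omega>))) * indicator (space M) \<omega> \<partial>M)
      = (\<integral>\<^sup>+\<omega>. (\<Prod>i\<in>I. ennreal (exp ((- s * c i) * X i \<omega>))) \<partial>M)"
    by (intro nn_integral_cong)
       (simp add: sum_distrib_left exp_sum I prod_ennreal mult.assoc flip: sum_negf)
  also have "\<dots> = (\<Prod>i\<in>I. \<integral>\<^sup>+\<omega>. ennreal (exp ((- s * c i) * X i \<omega>)) \<partial>M)"
  proof (rule indep_vars_nn_integral[OF I])
    show "indep_vars (\<lambda>_. borel) (\<lambda>i \<omega>. ennreal (exp ((- s * c i) * X i \<omega>))) I"
      by (rule indep_vars_compose2[OF indep, where Y = "\<lambda>i x. ennreal (exp ((- s * c i) * x))"]) simp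
  qed simp
  also have "\<dots> = (\<Prod>i\<in>I. ennreal (exp ((- s * c i)\<^sup>2 / 2)))"
    by (intro prod.cong refl nn_integral_exp_std_normal distr)
  also have "\<dots> = ennreal (exp (\<Sum>i\<in>I. (- s * c i)\<^sup>2 / 2))"
    by (simp add: prod_ennreal exp_sum I)
  also have "(\<Sum>i\<in>I. (- s * c i)\<^sup>2 / 2) = s\<^sup>2 * V / 2"
    by (simp add: power_mult_distrib sum_distrib_left flip: V(1) sum_divide_distrib)
  also have "ennreal (exp (s * - t)) * ennreal (exp (s\<^sup>2 * V / 2)) = ennreal (exp (- (t\<^sup>2 / (2 * V))))"
    using V(2) by (simp add: s_def mult_exp_exp power2_eq_square field_simps flip: ennreal_mult)
  finally show ?thesis by (simp add: emeasure_eq_measure)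
qed

text \<open>Only the mass of the interval of length \<open>\<sigma>\<close> to the left of
  \<open>- u\<close> is used. The shift by 1 costs a factor that is subexponential in
  \<open>N\<close> when \<open>u / \<sigma>\<close> is of order \<open>sqrt N\<close>.\<close>

lemma (in prob_space) normal_lower_tail_ge:
  assumes distr: "distributed M lborel Y (\<lambda>x. ennreal (normal_density 0 \<sigma> x))"
    and \<sigma>: "0 < \<sigma>" and u: "0 \<le> u"
  shows "exp (- ((u / \<sigma> + 1)\<^sup>2 / 2)) / sqrt (2 * pi) \<le> prob {\<omega>\<in>space M. Y \<omega> < - u}"
proof -
  \<comment> \<open>\<open>?d\<close> is the value of the density at \<open>- u - \<sigma>\<close>,
    its minimum on that interval; the length \<open>\<sigma>\<close> cancels the last
    division.\<close>
  let ?d = "exp (- ((u / \<sigma> + 1)\<^sup>2 / 2)) / sqrt (2 * pi) / \<sigma>"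
  have "ennreal (?d * \<sigma>) = (\<integral>\<^sup>+x. ennreal ?d * indicator {- u - \<sigma>..<- u} x \<partial>lborel)"
    using \<sigma> by (simp add: nn_integral_cmult_indicator flip: ennreal_mult)
  also have "\<dots> \<le> (\<integral>\<^sup>+x. ennreal (normal_density 0 \<sigma> x) * indicator {..<- u} x \<partial>lborel)"
  proof (intro nn_integral_mono)
    fix x :: real
    show "ennreal ?d * indicator {- u - \<sigma>..<- u} x
        \<le> ennreal (normal_density 0 \<sigma> x) * indicator {..<- u} x"
    proof (cases "x \<in> {- u - \<sigma>..<- u}")
      case True
      have "x\<^sup>2 = (- x)\<^sup>2" by simp
      also have "\<dots> \<le> (u + \<sigma>)\<^sup>2" using True u by (intro power_mono) auto
      finally have "x\<^sup>2 / (2 * \<sigma>\<^sup>2) \<le> (u + \<sigma>)\<^sup>2 / (2 * \<sigma>\<^sup>2)" by (intro divide_right_mono) auto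
      also have "\<dots> = (u / \<sigma> + 1)\<^sup>2 / 2"
        using \<sigma> by (simp add: field_simps power2_eq_square)
      finally have "?d \<le> exp (- (x\<^sup>2 / (2 * \<sigma>\<^sup>2))) / sqrt (2 * pi) / \<sigma>"
        using \<sigma> by (intro divide_right_mono) auto
      also have "\<dots> = normal_density 0 \<sigma> x"
        using \<sigma> by (simp add: normal_density_def real_sqrt_mult)
      finally show ?thesis using True by (simp add: ennreal_leI)
    qed simp
  qed
  also have "\<dots> = emeasure M (Y -` {..<- u} \<inter> space M)"
    by (rule distributed_emeasure[OF distr, symmetric]) simp
  also have "Y -` {..<- u} \<inter> space M = {\<omega>\<in>space M. Y \<omega> < - u}" by auto
  finally show ?thesis using \<sigma> by (simp add: emeasure_eq_measure)
qed

section \<open>Square blocks of Gaussian couplings\<close>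

text \<open>One size at a time: the final theorem allows a separate probability space for each
  \<open>N\<close>.\<close>

locale gaussian_couplings = prob_space M for M :: "'a measure" +
  fixes N :: nat and J :: "nat \<Rightarrow> nat \<Rightarrow> 'a \<Rightarrow> real"
  assumes size_pos: "1 \<le> N"
    and indep: "indep_vars (\<lambda>_. borel) (\<lambda>(i, j). J i j) ({1..N} \<times> {1..N})"
    and std_normal: "\<And>i j. i \<in> {1..N} \<Longrightarrow> j \<in> {1..N} \<Longrightarrow>
      distributed M lborel (J i j) (\<lambda>x. ennreal (normal_density 0 1 x))"
begin

definition pairs :: "(nat \<times> nat) set" where
  "pairs = {1..N} \<times> {1..N}"

definition X :: "nat \<times> nat \<Rightarrow> 'a \<Rightarrow> real" where
  "X p = J (fst p) (snd p)"

text \<open>For \<open>A \<subseteq> {1..N}\<close> this is \<open>sqrt N\<close> times the energy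
  of the configuration supported on \<open>A\<close>.\<close>

definition block :: "nat set \<Rightarrow> 'a \<Rightarrow> real" where
  "block A \<omega> = (\<Sum>p\<in>A \<times> A. X p \<omega>)"

lemma block_full: "block {1..N} \<omega> = (\<Sum>p\<in>pairs. X p \<omega>)"
  by (simp add: block_def pairs_def)

lemma finite_pairs: "finite pairs"
  by (simp add: pairs_def)

lemma card_pairs: "card pairs = N * N"
  by (simp add: pairs_def)

lemma indep_X: "indep_vars (\<lambda>_. borel) X pairs"
proof -
  have "(\<lambda>(i, j). J i j) = X" by (auto simp: X_def)
  then show ?thesis using indep by (simp add: pairs_def)
qed

lemma distributed_X:
  "p \<in> pairs \<Longrightarrow> distributed M lborel (X p) (\<lambda>x. ennreal (normal_density 0 1 x))"
  using std_normal by (auto simp: pairs_def X_def)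

lemma random_variable_X: "p \<in> pairs \<Longrightarrow> X p \<in> borel_measurable M"
  using distributed_measurable[OF distributed_X] by simp

lemma block_pairs_subset: "A \<subseteq> {1..N} \<Longrightarrow> A \<times> A \<subseteq> pairs"
  by (auto simp: pairs_def)

lemma random_variable_block: "A \<subseteq> {1..N} \<Longrightarrow> block A \<in> borel_measurable M"
  unfolding block_def
  by (intro borel_measurable_sum random_variable_X) (use block_pairs_subset in blast)

text \<open>The block consists of \<open>(card A)\<^sup>2\<close> independent standard normals, so
  \<open>card A\<close> is the standard deviation, not the variance. The empty block is the constant
  0 and has no density.\<close>

lemma distributed_block:
  assumes "A \<subseteq> {1..N}" "A \<noteq> {}"
  shows "distributed M lborel (block A) (\<lambda>x. ennreal (normal_density 0 (real (card A)) x))"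
proof -
  have fin: "finite A" using assms(1) finite_subset by blast
  have "distributed M lborel (\<lambda>\<omega>. \<Sum>p\<in>A \<times> A. X p \<omega>)
      (normal_density (\<Sum>p\<in>A \<times> A. 0) (sqrt (\<Sum>p\<in>A \<times> A. 1\<^sup>2)))"
  proof (rule sum_indep_normal)
    show "indep_vars (\<lambda>_. borel) X (A \<times> A)"
      using indep_vars_subset[OF indep_X block_pairs_subset[OF assms(1)]] .
    show "distributed M lborel (X p) (\<lambda>x. ennreal (normal_density 0 1 x))" if "p \<in> A \<times> A" for p
      using distributed_X block_pairs_subset[OF assms(1)] that by blast
  qed (use assms fin in auto)
  then show ?thesis
    by (simp add: block_def[abs_def] card_cartesian_product)
qed

section \<open>Lower bound for the first moment\<close>

text \<open>Linearity of expectation reduces the count to tail probabilities. Only sets of size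
  \<open>k\<close> are kept; the size is tuned to a favourable density in the final proof.\<close>

lemma expected_count_ge:
  assumes k: "0 < k" "k < N" and m: "0 < m"
  shows "real (N choose k) *
      (exp (- ((m * sqrt (real N) / (real k / real N) + 1)\<^sup>2 / 2)) / sqrt (2 * pi))
    \<le> (\<integral>\<omega>. real (low_energy_count N (\<lambda>i j. J i j \<omega>) m) \<partial>M)"
proof -
  let ?u = "m * real N * sqrt (real N)"
  let ?q = "exp (- ((m * sqrt (real N) / (real k / real N) + 1)\<^sup>2 / 2)) / sqrt (2 * pi)"
  let ?E = "\<lambda>A. {\<omega>\<in>space M. block A \<omega> < - ?u}"
  let ?S = "{A. A \<subseteq> {1..N} \<and> card A = k}"
  have E: "?E A \<in> sets M" if "A \<in> Pow {1..N}" for A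
  proof -
    have [measurable]: "block A \<in> borel_measurable M" using random_variable_block that by simp
    show ?thesis by measurable
  qed
  have "real (N choose k) * ?q = (\<Sum>A\<in>?S. ?q)"
    by (simp add: n_subsets)
  also have "\<dots> \<le> (\<Sum>A\<in>?S. prob (?E A))"
  proof (rule sum_mono)
    fix A assume "A \<in> ?S"
    then have A: "A \<subseteq> {1..N}" "A \<noteq> {}" "card A = k" using k by auto
    have "m * sqrt (real N) / (real k / real N) = ?u / real (card A)"
      using A by (simp add: mult_ac)
    then show "?q \<le> prob (?E A)"
      using normal_lower_tail_ge[OF distributed_block[OF A(1,2)], of ?u] A k m by (simp only:) simp
  qed
  also have "\<dots> \<le> (\<Sum>A\<in>Pow {1..N}. prob (?E A))"
    by (intro sum_mono2) auto
  also have "\<dots> = (\<Sum>A\<in>Pow {1..N}. \<integral>\<omega>. indicator (?E A) \<omega> \<partial>M)"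
    using E by (intro sum.cong refl) simp
  also have "\<dots> = (\<integral>\<omega>. (\<Sum>A\<in>Pow {1..N}. indicator (?E A) \<omega>) \<partial>M)"
    using E by (intro Bochner_Integration.integral_sum[symmetric]) (simp add: emeasure_eq_measure)
  also have "\<dots> = (\<integral>\<omega>. real (low_energy_count N (\<lambda>i j. J i j \<omega>) m) \<partial>M)"
  proof (rule Bochner_Integration.integral_cong[OF refl])
    fix \<omega> assume \<omega>: "\<omega> \<in> space M"
    have "(\<Sum>A\<in>Pow {1..N}. indicator (?E A) \<omega> :: real)
        = real (card {A \<in> Pow {1..N}. block A \<omega> < - ?u})"
      using \<omega> by (simp add: indicator_def sum.If_cases Int_def)
    then show "(\<Sum>A\<in>Pow {1..N}. indicator (?E A) \<omega>)
        = real (low_energy_count N (\<lambda>i j. J i j \<omega>) m)"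
      by (simp add: low_energy_count_eq[OF size_pos] block_def X_def)
  qed
  finally show ?thesis .
qed

section \<open>Splitting off the total, and the union bound\<close>

text \<open>The subtracted constant is the mean of the indicator of \<open>A \<times> A\<close> over
  all pairs, so the sum is \<open>N\<^sup>2\<close> times a Bernoulli variance.\<close>

lemma sum_square_block_coefficients:
  assumes "A \<subseteq> {1..N}"
  shows "(\<Sum>p\<in>pairs. (indicator (A \<times> A) p - (real (card A) / real N)\<^sup>2)\<^sup>2)
    = (real N)\<^sup>2 * ((real (card A) / real N)\<^sup>2 * (1 - (real (card A) / real N)\<^sup>2))"
proof -
  define a where "a = (real (card A) / real N)\<^sup>2"
  have fin: "finite A" using assms finite_subset by blast
  have Na: "(real N)\<^sup>2 * a = (real (card A))\<^sup>2"
    using size_pos by (simp add: a_def power_divide)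
  have ind: "(\<Sum>p\<in>pairs. indicator (A \<times> A) p :: real) = (real (card A))\<^sup>2"
  proof -
    have "(\<Sum>p\<in>pairs. indicator (A \<times> A) p :: real) = (\<Sum>p\<in>A \<times> A. 1)"
      using block_pairs_subset[OF assms] finite_pairs
      by (intro sum.mono_neutral_cong_right) auto
    then show ?thesis by (simp add: card_cartesian_product power2_eq_square)
  qed
  \<comment> \<open>An indicator equals its square, so the expanded square is affine in it.\<close>
  have "(\<Sum>p\<in>pairs. (indicator (A \<times> A) p - a)\<^sup>2)
      = (\<Sum>p\<in>pairs. (1 - 2 * a) * indicator (A \<times> A) p + a\<^sup>2)"
    by (intro sum.cong refl) (auto simp: indicator_def power2_eq_square algebra_simps)
  also have "\<dots> = (1 - 2 * a) * (real (card A))\<^sup>2 + (real N)\<^sup>2 * a\<^sup>2"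
    by (simp only: sum.distrib ind flip: sum_distrib_left) (simp add: card_pairs power2_eq_square)
  also have "\<dots> = (real N)\<^sup>2 * (a * (1 - a))"
    unfolding Na[symmetric] by (simp add: power2_eq_square algebra_simps)
  finally show ?thesis by (simp only: a_def)
qed

text \<open>The part of the block sum that is uncorrelated with the sum of all couplings.\<close>

definition centered_block :: "nat set \<Rightarrow> 'a \<Rightarrow> real" where
  "centered_block A \<omega> =
     (\<Sum>p\<in>pairs. (indicator (A \<times> A) p - (real (card A) / real N)\<^sup>2) * X p \<omega>)"

text \<open>The coefficient of the total is the regression coefficient: covariance
  \<open>(card A)\<^sup>2\<close> over variance \<open>N\<^sup>2\<close>.\<close>

lemma block_eq_centered:
  assumes "A \<subseteq> {1..N}"
  shows "block A \<omega> = (real (card A) / real N)\<^sup>2 * block {1..N} \<omega> + centered_block A \<omega>"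
proof -
  have "block A \<omega> = (\<Sum>p\<in>pairs. indicator (A \<times> A) p * X p \<omega>)"
    unfolding block_def using block_pairs_subset[OF assms] finite_pairs
    by (intro sum.mono_neutral_cong_left) auto
  then show ?thesis
    by (simp only: centered_block_def block_full left_diff_distrib sum_subtractf sum_distrib_left)
qed

lemma prob_total_le:
  assumes "0 < \<epsilon>"
  shows "prob {\<omega>\<in>space M. block {1..N} \<omega> \<le> - (\<epsilon> * real N * sqrt (real N))}
    \<le> exp (- (\<epsilon>\<^sup>2 / 2 * real N))"
proof -
  have "prob {\<omega>\<in>space M. (\<Sum>p\<in>pairs. 1 * X p \<omega>) \<le> - (\<epsilon> * real N * sqrt (real N))}
      \<le> exp (- ((\<epsilon> * real N * sqrt (real N))\<^sup>2 / (2 * (real N * real N))))"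
    using assms size_pos
    by (intro gaussian_lower_tail_le finite_pairs indep_X distributed_X) (auto simp: card_pairs)
  also have "(\<epsilon> * real N * sqrt (real N))\<^sup>2 / (2 * (real N * real N)) = \<epsilon>\<^sup>2 / 2 * real N"
    using size_pos by (simp add: power_mult_distrib power2_eq_square[of "real N"])
  finally show ?thesis by (simp only: block_full mult_1_left)
qed

lemma prob_centered_block_le:
  assumes "A \<subseteq> {1..N}" "0 < card A" "card A < N" "0 < m"
  defines "\<alpha> \<equiv> real (card A) / real N"
  shows "prob {\<omega>\<in>space M. centered_block A \<omega> \<le> - (m * real N * sqrt (real N))}
    \<le> exp (- (m\<^sup>2 / (2 * \<alpha>\<^sup>2 * (1 - \<alpha>\<^sup>2)) * real N))"
proof -
  have \<alpha>: "0 < \<alpha>" "\<alpha> < 1" using assms by (auto simp: \<alpha>_def)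
  have V: "0 < \<alpha>\<^sup>2 * (1 - \<alpha>\<^sup>2)" using existence_weight_pos[OF \<alpha>] by simp
  have "prob {\<omega>\<in>space M. centered_block A \<omega> \<le> - (m * real N * sqrt (real N))}
      \<le> exp (- ((m * real N * sqrt (real N))\<^sup>2 / (2 * ((real N)\<^sup>2 * (\<alpha>\<^sup>2 * (1 - \<alpha>\<^sup>2))))))"
    unfolding centered_block_def
  proof (intro gaussian_lower_tail_le finite_pairs indep_X distributed_X)
    show "0 < (real N)\<^sup>2 * (\<alpha>\<^sup>2 * (1 - \<alpha>\<^sup>2))" using size_pos by (intro mult_pos_pos[OF _ V]) simp
  qed (use assms size_pos sum_square_block_coefficients in \<open>auto simp: \<alpha>_def\<close>)
  also have "(m * real N * sqrt (real N))\<^sup>2 / (2 * ((real N)\<^sup>2 * (\<alpha>\<^sup>2 * (1 - \<alpha>\<^sup>2))))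
      = m\<^sup>2 / (2 * \<alpha>\<^sup>2 * (1 - \<alpha>\<^sup>2)) * real N"
  proof -
    obtain v where v: "v = \<alpha>\<^sup>2 * (1 - \<alpha>\<^sup>2)" by blast
    show ?thesis
      using size_pos V unfolding mult.assoc[of 2 "\<alpha>\<^sup>2"] v[symmetric]
      by (simp add: power_mult_distrib)
  qed
  finally show ?thesis .
qed

text \<open>Because the squared density is at most 1, a total above its level lowers the block by at
  most \<open>\<epsilon> * N * sqrt N\<close>; the remainder has to supply the rest.\<close>

lemma low_energy_cases:
  assumes A: "A \<subseteq> {1..N}" and "0 < m" "0 < \<epsilon>"
    and low: "block A \<omega> < - ((m + \<epsilon>) * real N * sqrt (real N))"
    and total: "- (\<epsilon> * real N * sqrt (real N)) < block {1..N} \<omega>"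
  shows "0 < card A" "card A < N" "centered_block A \<omega> \<le> - (m * real N * sqrt (real N))"
proof -
  define \<alpha> where "\<alpha> = real (card A) / real N"
  define T where "T = real N * sqrt (real N)"
  have T: "0 < T" using size_pos by (simp add: T_def)
  have le: "card A \<le> N" using card_mono[OF _ A] by simp
  then have \<alpha>: "\<alpha>\<^sup>2 \<le> 1" using size_pos by (simp add: \<alpha>_def power_le_one)
  have "- (\<epsilon> * T) \<le> \<alpha>\<^sup>2 * (- (\<epsilon> * T))"
    using \<alpha> T assms(3) mult_right_mono[of "\<alpha>\<^sup>2" 1 "\<epsilon> * T"] by simp
  also have "\<dots> \<le> \<alpha>\<^sup>2 * block {1..N} \<omega>"
    using total by (intro mult_left_mono) (auto simp: T_def mult.assoc)
  finally show "centered_block A \<omega> \<le> - (m * real N * sqrt (real N))"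
    using block_eq_centered[OF A, of \<omega>] low by (simp add: \<alpha>_def T_def algebra_simps)
  have "(m + \<epsilon>) * T = m * T + \<epsilon> * T" "0 < m * T" "0 < \<epsilon> * T"
    using assms(2,3) T by (simp_all add: distrib_right)
  \<comment> \<open>The first inequality rules out the empty set, the second the full set, whose
    block is the total itself.\<close>
  then have "block A \<omega> < 0" "block A \<omega> < block {1..N} \<omega>"
    using low total by (simp_all add: T_def mult.assoc)
  then have "A \<noteq> {}" "A \<noteq> {1..N}" by (auto simp: block_def)
  then show "0 < card A" "card A < N"
    using A le card_subset_eq[OF _ A] finite_subset[OF A] by (auto simp: card_gt_0_iff le_less)
qed

text \<open>The level \<open>m\<close> is split: \<open>m - m\<^sub>1\<close> is conceded to the
  total and \<open>m\<^sub>1\<close> is left to the remainder, whose tail must beat an entropy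
  controlled by \<open>m\<^sub>0\<close>.\<close>

lemma prob_low_energy_le:
  assumes m: "0 < m\<^sub>0" "m\<^sub>0 < m\<^sub>1" "m\<^sub>1 < m"
    and bound: "\<And>\<alpha>. 0 < \<alpha> \<Longrightarrow> \<alpha> < 1 \<Longrightarrow> 2 * \<alpha>\<^sup>2 * (1 - \<alpha>\<^sup>2) * entropy_fn \<alpha> \<le> m\<^sub>0\<^sup>2"
  shows "\<P>(\<omega> in M. \<exists>\<eta>\<in>configs N. hamiltonian N (\<lambda>i j. J i j \<omega>) \<eta> < - m * real N)
    \<le> exp (- ((m - m\<^sub>1)\<^sup>2 / 2 * real N)) + real N * exp (- (2 * (m\<^sub>1\<^sup>2 - m\<^sub>0\<^sup>2) * real N))"
proof -
  let ?total = "{\<omega>\<in>space M. block {1..N} \<omega> \<le> - ((m - m\<^sub>1) * real N * sqrt (real N))}"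
  let ?E = "\<lambda>A. {\<omega>\<in>space M. centered_block A \<omega> \<le> - (m\<^sub>1 * real N * sqrt (real N))}"
  let ?S = "\<lambda>k. {A. A \<subseteq> {1..N} \<and> card A = k}"
  have [measurable]: "X p \<in> borel_measurable M" if "p \<in> pairs" for p
    using random_variable_X[OF that] .
  have E [measurable]: "?E A \<in> sets M" for A unfolding centered_block_def by measurable
  have [measurable]: "block {1..N} \<in> borel_measurable M" by (intro random_variable_block) simp
  have tot: "?total \<in> sets M" by measurable
  have fin: "finite (?S k)" for k by (rule finite_subset[of _ "Pow {1..N}"]) auto
  have incl: "{\<omega>\<in>space M. \<exists>\<eta>\<in>configs N. hamiltonian N (\<lambda>i j. J i j \<omega>) \<eta> < - m * real N}
      \<subseteq> ?total \<union> (\<Union>k\<in>{0<..<N}. \<Union>A\<in>?S k. ?E A)"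
  proof
    fix \<omega> assume \<omega>: "\<omega> \<in> {\<omega>\<in>space M. \<exists>\<eta>\<in>configs N. hamiltonian N (\<lambda>i j. J i j \<omega>) \<eta> < - m * real N}"
    then obtain A where A: "A \<subseteq> {1..N}" "block A \<omega> < - (m * real N * sqrt (real N))"
      using ex_low_energy_iff[OF size_pos, of "\<lambda>i j. J i j \<omega>" m] by (auto simp: block_def X_def)
    show "\<omega> \<in> ?total \<union> (\<Union>k\<in>{0<..<N}. \<Union>A\<in>?S k. ?E A)"
    proof (cases "\<omega> \<in> ?total")
      case False
      then have "0 < card A" "card A < N"
          "centered_block A \<omega> \<le> - (m\<^sub>1 * real N * sqrt (real N))"
        using low_energy_cases[OF A(1), of m\<^sub>1 "m - m\<^sub>1" \<omega>] A m \<omega> by auto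
      then have "card A \<in> {0<..<N}" "A \<in> ?S (card A)" "\<omega> \<in> ?E A" using A \<omega> by auto
      then show ?thesis by blast
    qed simp
  qed
  \<comment> \<open>Within one cardinality the union bound sets the entropy against the tail of the
    remainder.\<close>
  have level: "prob (\<Union>A\<in>?S k. ?E A) \<le> exp (- (2 * (m\<^sub>1\<^sup>2 - m\<^sub>0\<^sup>2) * real N))" if k: "k \<in> {0<..<N}" for k
  proof -
    define \<alpha> where "\<alpha> = real k / real N"
    define w where "w = 2 * \<alpha>\<^sup>2 * (1 - \<alpha>\<^sup>2)"
    have \<alpha>: "0 < \<alpha>" "\<alpha> < 1" using k by (auto simp: \<alpha>_def)
    have w: "0 < w" using existence_weight_pos[OF \<alpha>] by (simp add: w_def)
    \<comment> \<open>Completing the square gives \<open>w \<le> 1 / 2\<close>, so dividing by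
      \<open>w\<close> at least doubles the gap, and the rate is independent of
      \<open>k\<close>.\<close>
    have "w = 1 / 2 - 2 * (\<alpha>\<^sup>2 - 1 / 2)\<^sup>2" by (simp add: w_def power2_eq_square algebra_simps)
    then have w_le: "w \<le> 1 / 2" by simp
    have "prob (\<Union>A\<in>?S k. ?E A) \<le> (\<Sum>A\<in>?S k. prob (?E A))"
      using fin E by (intro measure_UNION_le) auto
    also have "\<dots> \<le> (\<Sum>A\<in>?S k. exp (- (m\<^sub>1\<^sup>2 / w * real N)))"
    proof (rule sum_mono)
      show "prob (?E A) \<le> exp (- (m\<^sub>1\<^sup>2 / w * real N))" if "A \<in> ?S k" for A
        using prob_centered_block_le[of A m\<^sub>1] that k m by (simp add: w_def \<alpha>_def)
    qed
    also have "\<dots> = real (N choose k) * exp (- (m\<^sub>1\<^sup>2 / w * real N))"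
      by (simp add: n_subsets)
    also have "\<dots> \<le> exp (real N * entropy_fn \<alpha>) * exp (- (m\<^sub>1\<^sup>2 / w * real N))"
      using binomial_le_exp_entropy[of k N] k by (simp add: \<alpha>_def)
    also have "\<dots> = exp (- ((m\<^sub>1\<^sup>2 / w - entropy_fn \<alpha>) * real N))"
      by (simp add: mult_exp_exp algebra_simps)
    also have "\<dots> \<le> exp (- (2 * (m\<^sub>1\<^sup>2 - m\<^sub>0\<^sup>2) * real N))"
    proof -
      have "entropy_fn \<alpha> \<le> m\<^sub>0\<^sup>2 / w"
        using bound[OF \<alpha>] w by (simp add: w_def pos_le_divide_eq mult.commute)
      moreover have "2 * (m\<^sub>1\<^sup>2 - m\<^sub>0\<^sup>2) \<le> (m\<^sub>1\<^sup>2 - m\<^sub>0\<^sup>2) / w"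
      proof -
        have "0 \<le> m\<^sub>1\<^sup>2 - m\<^sub>0\<^sup>2" using m by (simp add: power_mono)
        then have "2 * (m\<^sub>1\<^sup>2 - m\<^sub>0\<^sup>2) * w \<le> 2 * (m\<^sub>1\<^sup>2 - m\<^sub>0\<^sup>2) * (1 / 2)"
          using w_le by (intro mult_left_mono) auto
        then show ?thesis using w by (simp add: pos_le_divide_eq)
      qed
      ultimately have "2 * (m\<^sub>1\<^sup>2 - m\<^sub>0\<^sup>2) \<le> m\<^sub>1\<^sup>2 / w - entropy_fn \<alpha>"
        by (simp add: diff_divide_distrib)
      then have "2 * (m\<^sub>1\<^sup>2 - m\<^sub>0\<^sup>2) * real N \<le> (m\<^sub>1\<^sup>2 / w - entropy_fn \<alpha>) * real N"
        by (rule mult_right_mono) simp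
      then show ?thesis by simp
    qed
    finally show ?thesis .
  qed
  have U: "(\<Union>A\<in>?S k. ?E A) \<in> sets M" for k
    using fin E by (intro sets.finite_UN) auto
  have "\<P>(\<omega> in M. \<exists>\<eta>\<in>configs N. hamiltonian N (\<lambda>i j. J i j \<omega>) \<eta> < - m * real N)
      \<le> prob (?total \<union> (\<Union>k\<in>{0<..<N}. \<Union>A\<in>?S k. ?E A))"
    using U tot by (intro finite_measure_mono incl sets.Un sets.finite_UN) auto
  also have "\<dots> \<le> prob ?total + prob (\<Union>k\<in>{0<..<N}. \<Union>A\<in>?S k. ?E A)"
    using U tot by (intro measure_Un_le sets.finite_UN) auto
  also have "\<dots> \<le> prob ?total + (\<Sum>k\<in>{0<..<N}. prob (\<Union>A\<in>?S k. ?E A))"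
    using U by (intro add_left_mono measure_UNION_le) auto
  also have "\<dots> \<le> exp (- ((m - m\<^sub>1)\<^sup>2 / 2 * real N))
      + (\<Sum>k\<in>{0<..<N}. exp (- (2 * (m\<^sub>1\<^sup>2 - m\<^sub>0\<^sup>2) * real N)))"
    using m by (intro add_mono sum_mono level prob_total_le) auto
  also have "(\<Sum>k\<in>{0<..<N}. exp (- (2 * (m\<^sub>1\<^sup>2 - m\<^sub>0\<^sup>2) * real N)))
      \<le> real N * exp (- (2 * (m\<^sub>1\<^sup>2 - m\<^sub>0\<^sup>2) * real N))"
    by (simp add: mult_right_mono)
  finally show ?thesis by simp
qed

end

section \<open>Exponential rates and the conclusion\<close>

text \<open>Half of the smaller rate is spent on absorbing the prefactor
  \<open>1 + N\<close>.\<close>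

lemma exponentially_small_add_linear:
  assumes "0 < a" "0 < b" and le: "\<And>N. 1 \<le> N \<Longrightarrow> p N \<le> exp (- (a * real N)) + real N * exp (- (b * real N))"
  shows "exponentially_small p"
  unfolding exponentially_small_def
proof (intro exI conjI)
  define c where "c = min a b / 2"
  show "0 < c" using assms(1,2) by (simp add: c_def)
  then have "\<forall>\<^sub>F N in sequentially. 1 + real N \<le> exp (c * real N)"
    by real_asymp
  then show "\<forall>\<^sub>F N in sequentially. p N \<le> exp (- c * real N)"
    using eventually_ge_at_top[of 1]
  proof eventually_elim
    case (elim N)
    have ab: "2 * c \<le> a" "2 * c \<le> b" by (simp_all add: c_def)
    have "p N \<le> exp (- (a * real N)) + real N * exp (- (b * real N))"
      using le elim(2) by blast
    also have "\<dots> \<le> exp (- (2 * c * real N)) + real N * exp (- (2 * c * real N))"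
      using ab by (intro add_mono mult_left_mono) (auto intro: mult_right_mono)
    also have "\<dots> = (1 + real N) * exp (- (2 * c * real N))"
      by (simp add: distrib_right)
    also have "\<dots> \<le> exp (c * real N) * exp (- (2 * c * real N))"
      using elim(1) by (intro mult_right_mono) auto
    also have "\<dots> = exp (- c * real N)"
      by (simp add: mult_exp_exp)
    finally show ?case .
  qed
qed

text \<open>The density \<open>k / N\<close> varies with \<open>N\<close>, so the available rate
  only converges; eventually it exceeds half its positive limit.\<close>

lemma exponentially_largeI:
  assumes "r \<longlonglongrightarrow> l" "0 < l" "\<forall>\<^sub>F N in sequentially. exp (r N * real N) \<le> x N"
  shows "exponentially_large x"
  unfolding exponentially_large_def
proof (intro exI conjI)
  show "0 < l / 2" using assms(2) by simp
  have "\<forall>\<^sub>F N in sequentially. l / 2 < r N"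
    using assms(1,2) by (intro order_tendstoD(1)) auto
  then show "\<forall>\<^sub>F N in sequentially. exp (l / 2 * real N) \<le> x N"
    using assms(3)
  proof eventually_elim
    case (elim N)
    have "l / 2 * real N \<le> r N * real N"
      using elim(1) by (intro mult_right_mono) auto
    then have "exp (l / 2 * real N) \<le> exp (r N * real N)"
      by (simp only: exp_le_cancel_iff)
    then show ?case using elim(2) by (rule order_trans)
  qed
qed

lemma tendsto_nat_floor_mult_div:
  assumes "0 \<le> a"
  shows "(\<lambda>N. real (nat \<lfloor>a * real N\<rfloor>) / real N) \<longlonglongrightarrow> a"
proof (rule tendsto_sandwich)
  show "(\<lambda>N. a - 1 / real N) \<longlonglongrightarrow> a"
    using tendsto_diff[OF tendsto_const lim_1_over_n, of a] by simp
  show "(\<lambda>N. a) \<longlonglongrightarrow> a" by simp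
  show "\<forall>\<^sub>F N in sequentially. a - 1 / real N \<le> real (nat \<lfloor>a * real N\<rfloor>) / real N"
    using eventually_gt_at_top[of 0]
  proof eventually_elim
    case (elim N)
    have "a * real N - 1 \<le> real (nat \<lfloor>a * real N\<rfloor>)" by linarith
    then have "(a * real N - 1) / real N \<le> real (nat \<lfloor>a * real N\<rfloor>) / real N"
      by (rule divide_right_mono) simp
    then show ?case using elim by (simp add: diff_divide_distrib)
  qed
  show "\<forall>\<^sub>F N in sequentially. real (nat \<lfloor>a * real N\<rfloor>) / real N \<le> a"
    using eventually_gt_at_top[of 0]
  proof eventually_elim
    case (elim N)
    have "real (nat \<lfloor>a * real N\<rfloor>) \<le> a * real N" using assms by simp
    then show ?case using elim by (simp add: field_simps)
  qed
qed

lemma isCont_entropy_fn: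
  assumes "0 < \<alpha>" "\<alpha> < 1"
  shows "isCont entropy_fn \<alpha>"
  unfolding entropy_fn_def[abs_def] using assms by (intro continuous_intros) auto

theorem mainTheorem3:
  fixes M :: "nat \<Rightarrow> 'a measure"
    and J :: "nat \<Rightarrow> nat \<Rightarrow> nat \<Rightarrow> 'a \<Rightarrow> real"
  assumes "\<And>N. N \<ge> 1 \<Longrightarrow> prob_space (M N)"
    and "\<And>N. N \<ge> 1 \<Longrightarrow>
           prob_space.indep_vars (M N) (\<lambda>_. borel) (\<lambda>(i, j). J N i j) ({1..N} \<times> {1..N})"
    and "\<And>N i j. N \<ge> 1 \<Longrightarrow> i \<in> {1..N} \<Longrightarrow> j \<in> {1..N} \<Longrightarrow>
           distributed (M N) lborel (J N i j) (\<lambda>x. ennreal (normal_density 0 1 x))"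
  shows "\<bar>existence_threshold - 0.562\<bar> < 0.0005 \<and>
         \<bar>first_moment_threshold - 0.801\<bar> < 0.0005 \<and>
         (\<forall>m. existence_threshold < m \<and> m < first_moment_threshold \<longrightarrow>
            exponentially_small
              (\<lambda>N. \<P>(\<omega> in M N. \<exists>\<eta>\<in>configs N. hamiltonian N (\<lambda>i j. J N i j \<omega>) \<eta> < - m * real N)) \<and>
            exponentially_large
              (\<lambda>N. \<integral>\<omega>. real (low_energy_count N (\<lambda>i j. J N i j \<omega>) m) \<partial>M N))"
proof (intro conjI allI impI)
  have decimals: "(0.562 :: real) = 281/500" "(0.801 :: real) = 801/1000" "(0.0005 :: real) = 1/2000"
    by simp_all
  show "\<bar>existence_threshold - 0.562\<bar> < 0.0005"
    unfolding decimals abs_diff_less_iff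
    using existence_threshold_bounds[unfolded atLeastAtMost_iff] by linarith
  show "\<bar>first_moment_threshold - 0.801\<bar> < 0.0005"
    unfolding decimals abs_diff_less_iff
    using first_moment_threshold_bounds[unfolded atLeastAtMost_iff] by linarith
next
  have couplings: "gaussian_couplings (M N) N (J N)" if "1 \<le> N" for N
    unfolding gaussian_couplings_def gaussian_couplings_axioms_def
    using assms(1)[OF that] assms(2)[OF that] assms(3)[OF that] that by blast
  fix m assume m: "existence_threshold < m \<and> m < first_moment_threshold"
  have m_pos: "0 < m"
    using m existence_threshold_bounds[unfolded atLeastAtMost_iff] by linarith
  show "exponentially_small
      (\<lambda>N. \<P>(\<omega> in M N. \<exists>\<eta>\<in>configs N. hamiltonian N (\<lambda>i j. J N i j \<omega>) \<eta> < - m * real N))"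
  proof -
    have "Inf (decay_bounds (\<lambda>\<alpha>. 2 * \<alpha>\<^sup>2 * (1 - \<alpha>\<^sup>2))) < m"
      using m by (simp only: existence_threshold_eq)
    then obtain m\<^sub>0 where m0: "0 < m\<^sub>0" "m\<^sub>0 < m"
        "\<And>\<alpha>. 0 < \<alpha> \<Longrightarrow> \<alpha> < 1 \<Longrightarrow> 2 * \<alpha>\<^sup>2 * (1 - \<alpha>\<^sup>2) * entropy_fn \<alpha> \<le> m\<^sub>0\<^sup>2"
      by (rule exponent_bound_above_Inf[OF existence_weight_pos, rotated 3])
         (use mem_existence_decay_bounds in auto)
    define m\<^sub>1 where "m\<^sub>1 = (m\<^sub>0 + m) / 2"
    \<comment> \<open>The midpoint leaves room on both sides: above it for the total, below it
      against the entropy.\<close>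
    have m1: "m\<^sub>0 < m\<^sub>1" "m\<^sub>1 < m" using m0 by (simp_all add: m\<^sub>1_def)
    show ?thesis
    proof (rule exponentially_small_add_linear)
      show "0 < (m - m\<^sub>1)\<^sup>2 / 2" using m1 by simp
      show "0 < 2 * (m\<^sub>1\<^sup>2 - m\<^sub>0\<^sup>2)" using m0(1) m1(1) by (simp add: power_strict_mono)
      show "\<P>(\<omega> in M N. \<exists>\<eta>\<in>configs N. hamiltonian N (\<lambda>i j. J N i j \<omega>) \<eta> < - m * real N)
          \<le> exp (- ((m - m\<^sub>1)\<^sup>2 / 2 * real N)) + real N * exp (- (2 * (m\<^sub>1\<^sup>2 - m\<^sub>0\<^sup>2) * real N))"
        if "1 \<le> N" for N
        using gaussian_couplings.prob_low_energy_le[OF couplings[OF that] m0(1) m1 m0(3)] .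
    qed
  qed
  show "exponentially_large (\<lambda>N. \<integral>\<omega>. real (low_energy_count N (\<lambda>i j. J N i j \<omega>) m) \<partial>M N)"
  proof -
    have "m < Inf (decay_bounds (\<lambda>\<alpha>. 2 * \<alpha>\<^sup>2))"
      using m by (simp only: first_moment_threshold_eq)
    \<comment> \<open>Since \<open>m\<close> lies below the infimum, some density has a positive
      first-moment exponent; sets of approximately that density are counted.\<close>
    then obtain \<alpha> where \<alpha>: "0 < \<alpha>" "\<alpha> < 1" "m\<^sup>2 < 2 * \<alpha>\<^sup>2 * entropy_fn \<alpha>"
      by (rule exponent_gt_below_Inf[OF first_moment_weight_pos m_pos, rotated])
    define k where "k N = nat \<lfloor>\<alpha> * real N\<rfloor>" for N
    define a where "a N = real (k N) / real N" for N
    \<comment> \<open>The exponent per site guaranteed at size \<open>N\<close>: the entropy, the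
      Gaussian cost with its shift by 1 rescaled to \<open>1 / sqrt N\<close>, and the polynomial
      prefactors.\<close>
    define r where "r N = entropy_fn (a N) - (m / a N + 1 / sqrt (real N))\<^sup>2 / 2
        - ln ((real N + 1) * sqrt (2 * pi)) / real N" for N
    have a_lim: "a \<longlonglongrightarrow> \<alpha>"
      unfolding a_def[abs_def] k_def using \<alpha> by (intro tendsto_nat_floor_mult_div) simp
    have "(\<lambda>N. 1 / sqrt (real N)) \<longlonglongrightarrow> 0"
      by real_asymp
    moreover have "(\<lambda>N. ln ((real N + 1) * sqrt (2 * pi)) / real N) \<longlonglongrightarrow> 0"
      by real_asymp
    ultimately have "r \<longlonglongrightarrow> entropy_fn \<alpha> - (m / \<alpha> + 0)\<^sup>2 / 2 - 0"
      unfolding r_def[abs_def] using \<alpha>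
      by (intro tendsto_intros a_lim isCont_tendsto_compose[OF isCont_entropy_fn]) auto
    then have r_lim: "r \<longlonglongrightarrow> entropy_fn \<alpha> - m\<^sup>2 / (2 * \<alpha>\<^sup>2)"
      by (simp add: power_divide mult.commute)
    show ?thesis
    proof (rule exponentially_largeI[OF r_lim])
      show "0 < entropy_fn \<alpha> - m\<^sup>2 / (2 * \<alpha>\<^sup>2)"
        using \<alpha> by (simp add: pos_divide_less_eq mult.commute)
      have "\<forall>\<^sub>F N in sequentially. 0 < a N" "\<forall>\<^sub>F N in sequentially. a N < 1"
        using order_tendstoD[OF a_lim] \<alpha> by auto
      then show "\<forall>\<^sub>F N in sequentially.
          exp (r N * real N) \<le> (\<integral>\<omega>. real (low_energy_count N (\<lambda>i j. J N i j \<omega>) m) \<partial>M N)"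
        using eventually_ge_at_top[of 1]
      proof eventually_elim
        case (elim N)
        have k: "0 < k N" "k N < N" using elim by (auto simp: a_def zero_less_divide_iff)
        let ?q = "exp (- ((m * sqrt (real N) / a N + 1)\<^sup>2 / 2)) / sqrt (2 * pi)"
        have "(m / a N + 1 / sqrt (real N))\<^sup>2 * real N = ((m / a N + 1 / sqrt (real N)) * sqrt (real N))\<^sup>2"
          by (simp add: power_mult_distrib)
        also have "(m / a N + 1 / sqrt (real N)) * sqrt (real N) = m * sqrt (real N) / a N + 1"
          using elim by (simp add: distrib_right)
        finally have sq: "(m / a N + 1 / sqrt (real N))\<^sup>2 * real N = (m * sqrt (real N) / a N + 1)\<^sup>2" .
        have "r N * real N = real N * entropy_fn (a N) + - ((m * sqrt (real N) / a N + 1)\<^sup>2 / 2)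
            - ln ((real N + 1) * sqrt (2 * pi))"
          using elim by (simp add: r_def left_diff_distrib flip: sq)
        then have "exp (r N * real N) = exp (real N * entropy_fn (a N))
            * exp (- ((m * sqrt (real N) / a N + 1)\<^sup>2 / 2)) / ((real N + 1) * sqrt (2 * pi))"
          by (simp only: exp_diff exp_add) (simp add: exp_ln)
        also have "\<dots> = exp (real N * entropy_fn (a N)) * ?q / (real N + 1)"
          by simp
        \<comment> \<open>The factor \<open>N + 1\<close> lost in the binomial estimate is the one
          already subtracted in \<open>r\<close>.\<close>
        also have "\<dots> \<le> (real N + 1) * real (N choose k N) * ?q / (real N + 1)"
          unfolding a_def using exp_entropy_le_binomial[OF k]
          by (intro divide_right_mono mult_right_mono) auto
        also have "\<dots> = real (N choose k N) * ?q"
          by simp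
        also have "\<dots> \<le> (\<integral>\<omega>. real (low_energy_count N (\<lambda>i j. J N i j \<omega>) m) \<partial>M N)"
          using gaussian_couplings.expected_count_ge[OF couplings[OF elim(3)] k m_pos]
          by (simp add: a_def)
        finally show ?case .
      qed
    qed
  qed
qed

end
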